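(* Let $G$ be a connected undirected simple graph, $k$ a positive integer, and $\mathit{In}\neq\emptyset$ a set of vertices of $G$ such that $G[\mathit{In}]$ is connected. Then the procedure LIN-ENUM-V$(G,\mathit{In},k)$ outputs all $k$-graphlets of $G$ that contain $\mathit{In}$.
   Context: A $k$-graphlet of $G$ is a connected subgraph induced by a set of exactly $k$ vertices (identified with its vertex set); it contains $\mathit{In}$ if its vertex set contains $\mathit{In}$. For a vertex set $U$, $N(U)=\bigcup_{u\in U}N(u)\setminus U$ is its open neighbourhood. A vertex $v$ is mandatory for $G,\mathit{In},k$ if the connected component of $G-v$ containing the vertices of $\mathit{In}$ has at most $k-1$ vertices. Procedure LIN-ENUM-V$(G,\mathit{In},k)$: (1) if $|\mathit{In}|=k$, output $\mathit{In}$ and return; (2) while $N(\mathit{In})$ contains a mandatory vertex $u$ (for $G,\mathit{In},k$): set $\mathit{In}\gets\mathit{In}\cup\{u\}$, and if now $|\mathit{In}|=k$, output $\mathit{In}$ and return; (3) let $v$ be a vertex of $N(\mathit{In})$ (necessarily non-mandatory); call LIN-ENUM-V$(G,\mathit{In}\cup\{v\},k)$ and then LIN-ENUM-V$(G-v,\mathit{In},k)$. *)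

theory Defs
  imports "Graph_Theory.Graph_Theory"
begin

definition nbhd :: "('a, 'b) pre_digraph \<Rightarrow> 'a set \<Rightarrow> 'a set" where
  "nbhd G U = (\<Union>u\<in>U. {w. u \<rightarrow>\<^bsub>G\<^esub> w}) - U"

definition graphlets :: "('a, 'b) pre_digraph \<Rightarrow> nat \<Rightarrow> 'a set set" where
  "graphlets G k = {U. U \<subseteq> verts G \<and> card U = k \<and> connected (G \<restriction> U)}"

definition connected_component :: "('a, 'b) pre_digraph \<Rightarrow> ('a, 'b) pre_digraph \<Rightarrow> bool" where
  "connected_component G C \<longleftrightarrow> pre_digraph.max_subgraph G connected C"

text \<open>Only used for \<open>v \<notin> In\<close> with \<open>In\<close> nonempty and inducing a connected subgraph, where the
  component \<open>C\<close> exists and is unique.\<close>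

definition mandatory :: "('a, 'b) pre_digraph \<Rightarrow> 'a set \<Rightarrow> nat \<Rightarrow> 'a \<Rightarrow> bool" where
  "mandatory G In k v \<longleftrightarrow>
     (\<exists>C. connected_component (pre_digraph.del_vert G v) C \<and> In \<subseteq> verts C \<and> card (verts C) \<le> k - 1)"

text \<open>
  The value is the sequence of output sets. The procedure leaves open which mandatory vertex \<open>u\<close>
  and which vertex \<open>v\<close> is taken; \<open>sel G In S\<close> is the element taken from the candidate set \<open>S\<close> in
  the state \<open>(G, In)\<close>. A run reaches no state twice, so selecting as a function of the state
  loses no behaviour.

  If \<open>N(In)\<close> is empty, there is no vertex to branch on and the call returns without output
  (this happens if \<open>G\<close> has fewer than \<open>k\<close> vertices, or if \<open>|In| > k\<close>).

  The equations are not known to terminate in general, e.g. for infinite graphs or a \<open>sel\<close> that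
  does not return candidates. The function is therefore partial: its equations are available only
  on its domain, the arguments whose recursion tree is well-founded.
\<close>

function (domintros)
  lin_enum_v :: "(('a, 'b) pre_digraph \<Rightarrow> 'a set \<Rightarrow> 'a set \<Rightarrow> 'a) \<Rightarrow>
    ('a, 'b) pre_digraph \<Rightarrow> 'a set \<Rightarrow> nat \<Rightarrow> 'a set list" and
  lin_enum_v_loop :: "(('a, 'b) pre_digraph \<Rightarrow> 'a set \<Rightarrow> 'a set \<Rightarrow> 'a) \<Rightarrow>
    ('a, 'b) pre_digraph \<Rightarrow> 'a set \<Rightarrow> nat \<Rightarrow> 'a set list"
where
  "lin_enum_v sel G In k =
     (if card In = k then [In] else lin_enum_v_loop sel G In k)"
| "lin_enum_v_loop sel G In k =
     (if \<exists>u\<in>nbhd G In. mandatory G In k u then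
        let u = sel G In {u \<in> nbhd G In. mandatory G In k u};
            In' = In \<union> {u}
        in if card In' = k then [In'] else lin_enum_v_loop sel G In' k
      else if nbhd G In = {} then []
      else
        let v = sel G In (nbhd G In)
        in lin_enum_v sel G (In \<union> {v}) k @ lin_enum_v sel (pre_digraph.del_vert G v) In k)"
  by pat_completeness auto

definition lin_enum_v_terminates ::
  "(('a, 'b) pre_digraph \<Rightarrow> 'a set \<Rightarrow> 'a set \<Rightarrow> 'a) \<Rightarrow>
    ('a, 'b) pre_digraph \<Rightarrow> 'a set \<Rightarrow> nat \<Rightarrow> bool" where
  "lin_enum_v_terminates sel G In k \<longleftrightarrow> lin_enum_v_lin_enum_v_loop_dom (Inl (sel, G, In, k))"

end

theory Submission
  imports Defs
begin

text \<open>
  Connectivity is used through its cut characterisation: every proper nonempty vertex set is left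
  by an arc. It shows that two overlapping connected vertex sets have a connected union, so a
  graphlet avoiding a vertex \<open>v\<close> and containing \<open>In\<close> lies inside the component of \<open>G - v\<close> around
  \<open>In\<close>; hence a mandatory vertex belongs to every \<open>k\<close>-graphlet containing \<open>In\<close>. Branching on \<open>v\<close>
  splits the remaining graphlets into those that contain \<open>v\<close> and those that are graphlets of
  \<open>G - v\<close>. Every step enlarges \<open>In\<close> or shrinks \<open>G\<close>, so the number of vertices outside \<open>In\<close>
  decreases.
\<close>

lemma connected_iff_cut:
  "connected G \<longleftrightarrow> verts G \<noteq> {} \<and>
     (\<forall>S \<subseteq> verts G. S \<noteq> {} \<longrightarrow> S \<noteq> verts G \<longrightarrow>
        (\<exists>u\<in>S. \<exists>v\<in>verts G - S. u \<rightarrow>\<^bsub>G\<^esub> v \<or> v \<rightarrow>\<^bsub>G\<^esub> u))"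
  (is "_ \<longleftrightarrow> _ \<and> ?cut")
proof -
  let ?R = "rtrancl_on (verts G) ((arcs_ends G)\<^sup>s)"
  have "(\<forall>u\<in>verts G. \<forall>v\<in>verts G. (u, v) \<in> ?R) \<longleftrightarrow> ?cut"
  proof (intro iffI allI impI ballI)
    fix S assume conn: "\<forall>u\<in>verts G. \<forall>v\<in>verts G. (u, v) \<in> ?R"
      and S: "S \<subseteq> verts G" "S \<noteq> {}" "S \<noteq> verts G"
    obtain a b where ab: "a \<in> S" "b \<in> verts G" "b \<notin> S" using S by blast
    show "\<exists>u\<in>S. \<exists>v\<in>verts G - S. u \<rightarrow>\<^bsub>G\<^esub> v \<or> v \<rightarrow>\<^bsub>G\<^esub> u"
    proof (rule ccontr)
      assume no: "\<not> ?thesis"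
      have "(a, b) \<in> ?R" using conn ab S by blast
      then have "b \<in> S"
        by (induction rule: rtrancl_on_induct) (use ab no in \<open>auto simp: symcl_def\<close>)
      with ab show False by simp
    qed
  next
    fix a b assume cut: ?cut and ab: "a \<in> verts G" "b \<in> verts G"
    \<comment> \<open>The vertices reachable from \<open>a\<close> in the symmetric closure. No arc
      joins this set to its complement in either direction, so the cut property forces it to be
      everything.\<close>
    let ?S = "{v \<in> verts G. (a, v) \<in> ?R}"
    have "?S = verts G"
    proof (rule ccontr)
      assume "?S \<noteq> verts G"
      moreover have "a \<in> ?S" using ab by auto
      ultimately obtain u v where "u \<in> ?S" "v \<in> verts G - ?S" "u \<rightarrow>\<^bsub>G\<^esub> v \<or> v \<rightarrow>\<^bsub>G\<^esub> u"
        using cut[rule_format, of ?S] by blast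
      then show False by (auto simp: symcl_def intro: rtrancl_on_into_rtrancl_on)
    qed
    with ab show "(a, b) \<in> ?R" by blast
  qed
  then show ?thesis unfolding connected_conv by blast
qed

lemma arcs_ends_induce_subgraph:
  "u \<rightarrow>\<^bsub>G \<restriction> U\<^esub> v \<longleftrightarrow> u \<rightarrow>\<^bsub>G\<^esub> v \<and> u \<in> U \<and> v \<in> U"
  by (auto simp: arcs_ends_conv)

text \<open>A cut either splits \<open>verts H\<close> properly, or has all of it on one side; in
  the latter case the overlap makes it split \<open>U\<close> properly. \<open>H\<close> is a
  subgraph and not a vertex set because it will be a component, which is not given as an induced
  subgraph.\<close>

lemma connected_induce_union:
  assumes "subgraph H G" "connected H" "connected (G \<restriction> U)" "verts H \<inter> U \<noteq> {}"
  shows "connected (G \<restriction> (verts H \<union> U))"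
  unfolding connected_iff_cut
proof (intro conjI allI impI; simp only: induce_subgraph_verts)
  show "verts H \<union> U \<noteq> {}" using assms(4) by blast
  fix S assume S: "S \<subseteq> verts H \<union> U" "S \<noteq> {}" "S \<noteq> verts H \<union> U"
  have "\<exists>u\<in>S. \<exists>v\<in>verts H \<union> U - S. u \<rightarrow>\<^bsub>G\<^esub> v \<or> v \<rightarrow>\<^bsub>G\<^esub> u"
  proof (cases "S \<inter> verts H \<noteq> {} \<and> \<not> verts H \<subseteq> S")
    case True
    then obtain u v where "u \<in> S \<inter> verts H" "v \<in> verts H - S \<inter> verts H" "u \<rightarrow>\<^bsub>H\<^esub> v \<or> v \<rightarrow>\<^bsub>H\<^esub> u"
      using assms(2)[unfolded connected_iff_cut, THEN conjunct2, rule_format, of "S \<inter> verts H"]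
      by blast
    then show ?thesis using arcs_ends_mono[OF assms(1)] by blast
  next
    case False
    then have "S \<inter> U \<noteq> {}" "S \<inter> U \<noteq> U" using S assms(4) by blast+
    then obtain u v where "u \<in> S \<inter> U" "v \<in> U - S \<inter> U" "u \<rightarrow>\<^bsub>G \<restriction> U\<^esub> v \<or> v \<rightarrow>\<^bsub>G \<restriction> U\<^esub> u"
      using assms(3)[unfolded connected_iff_cut, THEN conjunct2, rule_format, of "S \<inter> U"]
      by auto
    then show ?thesis by (auto simp: arcs_ends_induce_subgraph)
  qed
  then show "\<exists>u\<in>S. \<exists>v\<in>verts H \<union> U - S.
      u \<rightarrow>\<^bsub>G \<restriction> (verts H \<union> U)\<^esub> v \<or> v \<rightarrow>\<^bsub>G \<restriction> (verts H \<union> U)\<^esub> u"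
    using S(1) by (auto simp: arcs_ends_induce_subgraph)
qed

lemma connected_induce_insert_nbhd:
  assumes "connected (G \<restriction> J)" "v \<in> nbhd G J"
  shows "connected (G \<restriction> insert v J)"
  unfolding connected_iff_cut
proof (intro conjI allI impI; simp only: induce_subgraph_verts)
  show "insert v J \<noteq> {}" by simp
  fix S assume S: "S \<subseteq> insert v J" "S \<noteq> {}" "S \<noteq> insert v J"
  obtain w where w: "w \<in> J" "w \<rightarrow>\<^bsub>G\<^esub> v" "v \<notin> J" using assms(2) by (auto simp: nbhd_def)
  have "\<exists>x\<in>S. \<exists>y\<in>insert v J - S. x \<rightarrow>\<^bsub>G\<^esub> y \<or> y \<rightarrow>\<^bsub>G\<^esub> x"
  \<comment> \<open>Unless the arc from \<open>w\<close> to \<open>v\<close> itself crosses the cut,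
    its two ends are on the same side, and then \<open>S \<inter> J\<close> is a proper nonempty
    part of \<open>J\<close>.\<close>
  proof (cases "w \<in> S \<longleftrightarrow> v \<in> S")
    case True
    then have "S \<inter> J \<noteq> {}" "S \<inter> J \<noteq> J" using S w by blast+
    then obtain x y where "x \<in> S \<inter> J" "y \<in> J - S \<inter> J" "x \<rightarrow>\<^bsub>G \<restriction> J\<^esub> y \<or> y \<rightarrow>\<^bsub>G \<restriction> J\<^esub> x"
      using assms(1)[unfolded connected_iff_cut, THEN conjunct2, rule_format, of "S \<inter> J"]
      by auto
    then show ?thesis by (auto simp: arcs_ends_induce_subgraph)
  next
    case False
    then show ?thesis using w by blast
  qed
  then show "\<exists>x\<in>S. \<exists>y\<in>insert v J - S.
      x \<rightarrow>\<^bsub>G \<restriction> insert v J\<^esub> y \<or> y \<rightarrow>\<^bsub>G \<restriction> insert v J\<^esub> x"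
    using S(1) by (auto simp: arcs_ends_induce_subgraph)
qed

text \<open>Justifies returning without output when the neighbourhood is empty. Symmetry enters
  because \<open>nbhd\<close> follows outgoing arcs only, while the cut may supply an arc into
  \<open>J\<close>.\<close>

lemma (in sym_digraph) nbhd_nonempty_if_connected_superset:
  assumes "connected (G \<restriction> U)" "J \<subset> U" "J \<noteq> {}"
  shows "nbhd G J \<noteq> {}"
proof -
  obtain u v where "u \<in> J" "v \<in> U - J" "u \<rightarrow> v \<or> v \<rightarrow> u"
    using assms(1)[unfolded connected_iff_cut, THEN conjunct2, rule_format, of J] assms(2,3)
    by (auto simp: arcs_ends_induce_subgraph)
  then show ?thesis using graph_symmetric by (auto simp: nbhd_def)
qed

lemma (in wf_digraph) nbhd_subset_verts: "nbhd G J \<subseteq> verts G"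
  by (auto simp: nbhd_def)

lemma induce_del_vert:
  "v \<notin> U \<Longrightarrow> pre_digraph.del_vert G v \<restriction> U = G \<restriction> U"
  by (auto simp: induce_subgraph_def pre_digraph.del_vert_def)

lemma graphlets_del_vert:
  "graphlets (pre_digraph.del_vert G v) k = {U \<in> graphlets G k. v \<notin> U}"
  by (auto simp: graphlets_def pre_digraph.verts_del_vert induce_del_vert subset_Diff_insert)

lemma (in pseudo_graph) pseudo_graph_del_vert: "pseudo_graph (del_vert v)"
proof -
  interpret D: fin_digraph "del_vert v" by (rule fin_digraph_del_vert)
  have "symmetric (del_vert v)"
    using sym_arcs unfolding symmetric_conv by (auto simp: del_vert_simps)
  then show ?thesis by unfold_locales
qed

lemma (in fin_digraph) mandatory_in_graphlet:
  assumes "mandatory G J k v" "U \<in> graphlets G k" "J \<subseteq> U" "J \<noteq> {}" "k > 0"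
  shows "v \<in> U"
proof (rule ccontr)
  assume v: "v \<notin> U"
  interpret D: fin_digraph "del_vert v" by (rule fin_digraph_del_vert)
  from assms(1) obtain C where C: "D.max_subgraph connected C"
    and J: "J \<subseteq> verts C" and card: "card (verts C) \<le> k - 1"
    by (auto simp: mandatory_def connected_component_def)
  have sub: "subgraph C (del_vert v)" and conn: "connected C"
    using C by (auto simp: D.max_subgraph_def)
  have U: "U \<subseteq> verts (del_vert v)" "card U = k" "connected (del_vert v \<restriction> U)"
    using assms(2) v by (auto simp: graphlets_def verts_del_vert induce_del_vert)
  let ?H = "del_vert v \<restriction> (verts C \<union> U)"
  have "connected ?H"
    using sub conn U(3) J assms(3,4) by (intro connected_induce_union) auto
  moreover have subH: "subgraph ?H (del_vert v)"
    using sub U(1) by (intro D.subgraph_induce_subgraphI) auto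
  \<comment> \<open>An arc of \<open>C\<close> has both ends in \<open>verts C\<close>, and the same
    ends in \<open>del_vert v\<close> by compatibility, so the induced subgraph retains it.
    Maximality of \<open>C\<close> then yields \<open>?H = C\<close>.\<close>
  moreover have "subgraph C ?H"
  proof (rule subgraphI)
    interpret C: wf_digraph C using sub by auto
    show "arcs C \<subseteq> arcs ?H"
      using sub by (auto simp: subgraph_def compatible_def)
  qed (use sub subH in \<open>auto simp: subgraph_def compatible_def\<close>)
  ultimately have "?H = C" using C by (auto simp: D.max_subgraph_def)
  then have "U \<subseteq> verts C" by (metis Un_upper2 induce_subgraph_verts)
  moreover have "finite (verts C)"
    using sub D.finite_verts by (auto simp: subgraph_def intro: finite_subset)
  ultimately have "k \<le> card (verts C)" using U(2) card_mono by blast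
  \<comment> \<open>Subtraction on naturals is truncated: \<open>k \<le> k - 1\<close> is
    contradictory only for positive \<open>k\<close>.\<close>
  with card assms(5) show False by simp
qed

lemma graphlets_containing_eq_singleton:
  assumes "finite (verts G)" "J \<subseteq> verts G" "connected (G \<restriction> J)" "card J = k"
  shows "{U \<in> graphlets G k. J \<subseteq> U} = {J}"
proof -
  have "U = J" if "U \<subseteq> verts G" "card U = k" "J \<subseteq> U" for U
    using card_subset_eq[OF finite_subset[OF that(1) assms(1)] that(3)] that(2) assms(4) by simp
  then show ?thesis using assms by (auto simp: graphlets_def)
qed

text \<open>Isolates the size test at the start of a call, so that the induction can speak of
  \<open>lin_enum_v_loop\<close> alone.\<close>

lemma lin_enum_v_correct_if_loop:
  assumes "finite (verts G)" "J \<subseteq> verts G" "connected (G \<restriction> J)"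
    and "lin_enum_v_lin_enum_v_loop_dom (Inr (sel, G, J, k))"
    and "card J \<noteq> k \<Longrightarrow> set (lin_enum_v_loop sel G J k) = {U \<in> graphlets G k. J \<subseteq> U}"
  shows "lin_enum_v_lin_enum_v_loop_dom (Inl (sel, G, J, k))"
    and "set (lin_enum_v sel G J k) = {U \<in> graphlets G k. J \<subseteq> U}"
proof -
  show dom: "lin_enum_v_lin_enum_v_loop_dom (Inl (sel, G, J, k))"
    using assms(4) by (rule lin_enum_v_lin_enum_v_loop.domintros)
  show "set (lin_enum_v sel G J k) = {U \<in> graphlets G k. J \<subseteq> U}"
    using graphlets_containing_eq_singleton[OF assms(1-3), of k] assms(5)
    by (cases "card J = k") (simp_all add: lin_enum_v.psimps[OF dom])
qed

text \<open>Termination and output are proved in one induction, since the equations hold only on the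
  domain. The output claim excludes \<open>card J = k\<close>: there the only graphlet is
  \<open>J\<close> itself, which the loop would pass over. The invariant on \<open>G\<close> is
  \<open>pseudo_graph\<close>, which \<open>del_vert\<close> preserves.\<close>

lemma lin_enum_v_loop_correct:
  assumes "pseudo_graph G" "k > 0" "J \<noteq> {}" "J \<subseteq> verts G" "connected (G \<restriction> J)"
    and sel: "\<And>H J S. S \<noteq> {} \<Longrightarrow> sel H J S \<in> S"
  shows "lin_enum_v_lin_enum_v_loop_dom (Inr (sel, G, J, k)) \<and>
    (card J \<noteq> k \<longrightarrow> set (lin_enum_v_loop sel G J k) = {U \<in> graphlets G k. J \<subseteq> U})"
  using assms(1,3-5)
proof (induction "card (verts G - J)" arbitrary: G J rule: less_induct)
  case less
  interpret pseudo_graph G by (rule less.prems)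
  let ?M = "{u \<in> nbhd G J. mandatory G J k u}"
  let ?u = "sel G J ?M" and ?v = "sel G J (nbhd G J)"
  \<comment> \<open>For the steps that retain \<open>G\<close> and enlarge \<open>J\<close>:
    absorbing a mandatory vertex and the first branch.\<close>
  note insert_IH = less.hyps[OF _ less.prems(1) insert_not_empty]
  have insert: "insert w J \<subseteq> verts G" "connected (G \<restriction> insert w J)"
      "card (verts G - insert w J) < card (verts G - J)" if "w \<in> nbhd G J" for w
  proof -
    have w: "w \<in> verts G - J" using that nbhd_subset_verts by (auto simp: nbhd_def)
    then show "insert w J \<subseteq> verts G" using less.prems by blast
    show "connected (G \<restriction> insert w J)" using less.prems that by (intro connected_induce_insert_nbhd)
    show "card (verts G - insert w J) < card (verts G - J)"
      using w by (intro psubset_card_mono) auto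
  qed
  show ?case
  proof (cases "?M = {}")
    case False
    then have "?u \<in> ?M" by (rule sel)
    then have u: "?u \<in> nbhd G J" "mandatory G J k ?u" by auto
    have ex: "\<exists>u\<in>nbhd G J. mandatory G J k u" using u by blast
    note IH = insert_IH[OF insert(3,1,2), OF u(1) u(1) u(1)]
    \<comment> \<open>The introduction rule asks for all recursive calls of the equation; those of
      the branch not taken have guards that contradict \<open>ex\<close>.\<close>
    have dom: "lin_enum_v_lin_enum_v_loop_dom (Inr (sel, G, J, k))"
      by (rule lin_enum_v_lin_enum_v_loop.domintros(2); use IH[THEN conjunct1] ex in blast)
    have "{U \<in> graphlets G k. J \<subseteq> U} = {U \<in> graphlets G k. insert ?u J \<subseteq> U}"
      using mandatory_in_graphlet[OF u(2)] less.prems assms(2) by blast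
    then show ?thesis
      using dom ex IH[THEN conjunct2]
        graphlets_containing_eq_singleton[OF finite_verts insert(1,2), OF u(1) u(1), of k]
      by (cases "card (insert ?u J) = k") (simp_all add: lin_enum_v_loop.psimps[OF dom] Let_def)
  next
    case True
    then have nex: "\<not> (\<exists>u\<in>nbhd G J. mandatory G J k u)" by blast
    show ?thesis
    proof (cases "nbhd G J = {}")
      case True
      have dom: "lin_enum_v_lin_enum_v_loop_dom (Inr (sel, G, J, k))"
        by (rule lin_enum_v_lin_enum_v_loop.domintros(2); use True in blast)
      \<comment> \<open>No connected set properly contains \<open>J\<close>, so \<open>J\<close> is
        the only candidate, and it fails when \<open>card J \<noteq> k\<close>.\<close>
      have "U = J" if "U \<in> graphlets G k" "J \<subseteq> U" for U
        using nbhd_nonempty_if_connected_superset[of U J] that True less.prems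
        by (auto simp: graphlets_def)
      then have "{U \<in> graphlets G k. J \<subseteq> U} = {}" if "card J \<noteq> k"
        using that by (auto simp: graphlets_def)
      then show ?thesis using True nex dom by (simp add: lin_enum_v_loop.psimps[OF dom])
    next
      case False
      then have v: "?v \<in> nbhd G J" by (rule sel)
      then have vJ: "?v \<notin> J" "?v \<in> verts G" using nbhd_subset_verts by (auto simp: nbhd_def)
      let ?D = "del_vert ?v"
      \<comment> \<open>As \<open>?v\<close> lies outside \<open>J\<close>, its deletion leaves
        \<open>J\<close> and the subgraph induced by it intact, while one vertex outside
        \<open>J\<close> disappears.\<close>
      have D: "pseudo_graph ?D" "J \<subseteq> verts ?D" "connected (?D \<restriction> J)"
        "finite (verts ?D)" "card (verts ?D - J) < card (verts G - J)"
        using less.prems vJ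
        by (auto simp: verts_del_vert induce_del_vert pseudo_graph_del_vert
            intro!: psubset_card_mono)
      note IH1 = insert_IH[OF insert(3,1,2), OF v v v]
      note IH2 = less.hyps[OF D(5,1) less.prems(2) D(2,3)]
      have call1: "lin_enum_v_lin_enum_v_loop_dom (Inl (sel, G, insert ?v J, k))"
        "set (lin_enum_v sel G (insert ?v J) k) = {U \<in> graphlets G k. insert ?v J \<subseteq> U}"
        using lin_enum_v_correct_if_loop[OF finite_verts insert(1,2), OF v v] IH1 by blast+
      have call2: "lin_enum_v_lin_enum_v_loop_dom (Inl (sel, ?D, J, k))"
        "set (lin_enum_v sel ?D J k) = {U \<in> graphlets ?D k. J \<subseteq> U}"
        using lin_enum_v_correct_if_loop[OF D(4,2,3)] IH2 by blast+
      have dom: "lin_enum_v_lin_enum_v_loop_dom (Inr (sel, G, J, k))"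
        by (rule lin_enum_v_lin_enum_v_loop.domintros(2); use call1(1) call2(1) nex in blast)
      show ?thesis
        using dom False nex call1(2) call2(2)
        by (auto simp: lin_enum_v_loop.psimps[OF dom] Let_def graphlets_del_vert)
    qed
  qed
qed

theorem theorem2:
  fixes G :: "('a, 'b) pre_digraph" and In :: "'a set" and k :: nat
    and sel :: "('a, 'b) pre_digraph \<Rightarrow> 'a set \<Rightarrow> 'a set \<Rightarrow> 'a"
  assumes "graph G" and "connected G"
    and "k > 0"
    and "In \<noteq> {}" and "In \<subseteq> verts G" and "connected (G \<restriction> In)"
    and "\<And>H J S. S \<noteq> {} \<Longrightarrow> sel H J S \<in> S"
  shows "lin_enum_v_terminates sel G In k \<and>
         set (lin_enum_v sel G In k) = {U \<in> graphlets G k. In \<subseteq> U}"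
proof -
  interpret graph G by fact
  have "pseudo_graph G" by unfold_locales
  then have loop: "lin_enum_v_lin_enum_v_loop_dom (Inr (sel, G, In, k))"
    "card In \<noteq> k \<Longrightarrow> set (lin_enum_v_loop sel G In k) = {U \<in> graphlets G k. In \<subseteq> U}"
    using lin_enum_v_loop_correct[of G k In sel] assms(3-7) by simp_all
  show ?thesis
    unfolding lin_enum_v_terminates_def
    using lin_enum_v_correct_if_loop[OF finite_verts assms(5,6) loop] by (rule conjI)
qed

end
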